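(* Let $n\ge 2$ be an integer and let $$u_{2n}(x,t)=\frac{1}{2(nt)^{1/n}}\left[\mathrm{Ai}_{n}\left(\frac{x}{(nt)^{1/n}}\right)+\mathrm{Ai}_{n}\left(-\frac{x}{(nt)^{1/n}}\right)\right].$$ Then for all $x\in\mathbb{R}\setminus\{0\}$ and $t>0$, $$u_{2n}(x,t)=\frac{1}{\pi x}\,\mathbb{E}\left[\sin\left(a_n x\,G_{n}(1/t)\right)\cosh\left(b_n x\,G_{n}(1/t)\right)\right],$$ where $a_n=\cos\frac{\pi}{2n}$, $b_n=\sin\frac{\pi}{2n}$, and, for $\gamma,\tau>0$, $G_{\gamma}(\tau)$ denotes a random variable with Weibull distribution having probability density function $$g_{\gamma}(y;\tau)=\gamma\frac{y^{\gamma-1}}{\tau}\exp\left(-\frac{y^{\gamma}}{\tau}\right),\qquad y>0.$$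
   Context: For real $\alpha>1$ the generalized Airy function is $\mathrm{Ai}_{\alpha}(x)=\frac{1}{\pi}\int_0^{+\infty}\cos\left(sx+\frac{s^{\alpha}}{\alpha}\right)ds$, $x\in\mathbb{R}$ (convergent improper Riemann integral). *)

theory Defs
  imports "HOL-Probability.Probability" "HOL-Real_Asymp.Real_Asymp"
begin

text \<open>The integral over the half-line converges only conditionally, so it is taken as the limit
  of the integrals over \<open>{0..R}\<close> and not as a Lebesgue (or Henstock--Kurzweil) integral
  over \<open>{0..}\<close>. The limit exists for every \<open>\<alpha> > 1\<close>, see \<open>Ai_gen_convergent\<close> below.\<close>

definition Ai_gen :: "real \<Rightarrow> real \<Rightarrow> real" where
  "Ai_gen \<alpha> x =
     1 / pi * Lim at_top (\<lambda>R. integral {0..R} (\<lambda>s. cos (s * x + s powr \<alpha> / \<alpha>)))"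

definition u_even :: "nat \<Rightarrow> real \<Rightarrow> real \<Rightarrow> real" where
  "u_even n x t =
     1 / (2 * (real n * t) powr (1 / real n)) *
       (Ai_gen (real n) (x / (real n * t) powr (1 / real n)) +
        Ai_gen (real n) (- x / (real n * t) powr (1 / real n)))"

definition weibull_density :: "real \<Rightarrow> real \<Rightarrow> real \<Rightarrow> real" where
  "weibull_density \<gamma> \<tau> y =
     (if 0 < y then \<gamma> * (y powr (\<gamma> - 1) / \<tau>) * exp (- (y powr \<gamma> / \<tau>)) else 0)"

lemma mono_bounded_tendsto_at_top:
  fixes g :: "real \<Rightarrow> real"
  assumes mono: "\<And>R S. c \<le> R \<Longrightarrow> R \<le> S \<Longrightarrow> g R \<le> g S"
    and bound: "\<And>R. c \<le> R \<Longrightarrow> g R \<le> B"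
  shows "(g \<longlongrightarrow> (SUP R\<in>{c..}. g R)) at_top"
proof (rule order_tendstoI)
  have bdd: "bdd_above (g ` {c..})"
    using bound by (auto intro!: bdd_aboveI[where M = B])
  fix a
  {
    assume "a < (SUP R\<in>{c..}. g R)"
    then obtain S where S: "c \<le> S" "a < g S"
      using less_cSUP_iff[OF _ bdd, of a] by auto
    show "\<forall>\<^sub>F R in at_top. a < g R"
      using eventually_ge_at_top[of S]
      by eventually_elim (use S mono in \<open>force intro: less_le_trans\<close>)
  next
    assume a: "(SUP R\<in>{c..}. g R) < a"
    show "\<forall>\<^sub>F R in at_top. g R < a"
      using eventually_ge_at_top[of c]
      by eventually_elim (use cSUP_upper[OF _ bdd] a in \<open>force intro: le_less_trans\<close>)
  }
qed

lemma Ai_gen_convergent: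
  fixes \<alpha> x :: real
  assumes \<alpha>: "1 < \<alpha>"
  shows "\<exists>L. ((\<lambda>R. integral {0..R} (\<lambda>s. cos (s * x + s powr \<alpha> / \<alpha>))) \<longlongrightarrow> L) at_top"
proof -
  define p where "p = (\<lambda>s. s * x + s powr \<alpha> / \<alpha>)"
  define f where "f = (\<lambda>s. cos (p s))"
  define d where "d = (\<lambda>s. x + s powr (\<alpha> - 1))"
  define e where "e = (\<lambda>s. (\<alpha> - 1) * s powr (\<alpha> - 2))"
  define H where "H = (\<lambda>s. sin (p s) / d s)"
  define k where "k = (\<lambda>s. sin (p s) * (e s / (d s)\<^sup>2))"
  define c where "c = (\<bar>x\<bar> + 1) powr (1 / (\<alpha> - 1))"
  have c: "0 < c" by (simp add: c_def add_nonneg_pos)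
  have d: "1 \<le> d s" if "c \<le> s" for s
  proof -
    have "\<bar>x\<bar> + 1 = c powr (\<alpha> - 1)" using \<alpha> by (simp add: c_def powr_powr)
    also have "\<dots> \<le> s powr (\<alpha> - 1)" using that c \<alpha> by (intro powr_mono2) auto
    finally show ?thesis by (simp add: d_def)
  qed
  have e: "0 \<le> e s" for s using \<alpha> by (simp add: e_def)
  have powr': "((\<lambda>s. s powr r) has_real_derivative r * s powr (r - 1)) (at s within A)"
    if "0 < s" for s r :: real and A
    using has_real_derivative_powr[OF that] by (rule DERIV_subset) simp
  have d': "(d has_real_derivative e s) (at s within A)" if "0 < s" for s A
    unfolding d_def e_def using DERIV_add[OF DERIV_const powr'[OF that, of "\<alpha> - 1"]] by simp
  have phi': "(p has_real_derivative d s) (at s within A)"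
    if "0 < s" for s A
    unfolding d_def p_def
    using DERIV_add[OF DERIV_cmult_right[OF DERIV_ident, where c = x]
        DERIV_cdivide[OF powr'[OF that, where r = \<alpha>], where c = \<alpha>]] \<alpha> by simp
  have H': "(H has_real_derivative (f s - k s)) (at s within A)" if "c \<le> s" for s A
    unfolding H_def f_def k_def
    using c d[OF that] that
    by (auto intro!: derivative_eq_intros phi' d' simp: field_simps power2_eq_square)
  have D': "((\<lambda>s. - (1 / d s)) has_real_derivative (e s / (d s)\<^sup>2)) (at s within A)"
    if "c \<le> s" for s A
    using c d[OF that] that
    by (auto intro!: derivative_eq_intros d' simp: field_simps power2_eq_square)
  have FH: "((\<lambda>s. f s - k s) has_integral (H S - H R)) {R..S}" if "c \<le> R" "R \<le> S" for R S
    using that by (intro fundamental_theorem_of_calculus)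
      (auto simp: has_real_derivative_iff_has_vector_derivative[symmetric] intro: H')
  have FD: "((\<lambda>s. e s / (d s)\<^sup>2) has_integral (1 / d R - 1 / d S)) {R..S}"
    if "c \<le> R" "R \<le> S" for R S
    using fundamental_theorem_of_calculus[OF that(2), of "\<lambda>s. - (1 / d s)" "\<lambda>s. e s / (d s)\<^sup>2"] D' that
    by (simp add: has_real_derivative_iff_has_vector_derivative[symmetric])
  have fI: "f integrable_on {R..S}" if "0 \<le> R" for R S
    unfolding f_def p_def using \<alpha> that
    by (intro integrable_continuous_interval continuous_on_powr' continuous_intros) auto
  have kI: "k integrable_on {R..S}" if "c \<le> R" "R \<le> S" for R S
    using integrable_diff[OF fI has_integral_integrable[OF FH[OF that]]] c that by simp
  define g where "g = (\<lambda>s. k s + e s / (d s)\<^sup>2)"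
  have gI: "g integrable_on {R..S}" if "c \<le> R" "R \<le> S" for R S
    unfolding g_def by (intro integrable_add kI that has_integral_integrable[OF FD])
  have k_le: "\<bar>k s\<bar> \<le> e s / (d s)\<^sup>2" for s
    unfolding k_def abs_mult using e[of s]
    by (simp add: mult_left_le_one_le divide_right_mono)
  have g0: "0 \<le> g s" for s using k_le[of s] by (simp add: g_def abs_le_iff)
  have g2: "g s \<le> 2 * (e s / (d s)\<^sup>2)" for s using k_le[of s] by (simp add: g_def abs_le_iff)
  have lim_d: "((\<lambda>R. 1 / d R) \<longlongrightarrow> 0) at_top"
    unfolding d_def using \<alpha> by real_asymp
  have "integral {c..R} g \<le> integral {c..S} g" if "c \<le> R" "R \<le> S" for R S
    using that by (intro integral_subset_le gI) (auto intro: g0)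
  moreover have "integral {c..R} g \<le> 2 * (1 / d c)" if "c \<le> R" for R
  proof -
    have "integral {c..R} g \<le> 2 * (1 / d c - 1 / d R)"
      by (rule has_integral_le[OF integrable_integral[OF gI[OF order_refl that]]
            has_integral_mult_right[OF FD[OF order_refl that]]]) (rule g2)
    also have "\<dots> \<le> 2 * (1 / d c)" using d[OF that] by (intro mult_left_mono) auto
    finally show ?thesis .
  qed
  ultimately have limg: "((\<lambda>R. integral {c..R} g) \<longlongrightarrow> (SUP R\<in>{c..}. integral {c..R} g)) at_top"
    by (rule mono_bounded_tendsto_at_top)
  have limH: "(H \<longlongrightarrow> 0) at_top"
  proof (rule Lim_null_comparison[OF _ lim_d])
    show "\<forall>\<^sub>F R in at_top. norm (H R) \<le> 1 / d R"
      using eventually_ge_at_top[of c]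
      by eventually_elim (use d in \<open>force simp: H_def abs_mult intro!: divide_right_mono\<close>)
  qed
  have eq: "integral {0..R} f =
      integral {0..c} f + (H R - H c) + (integral {c..R} g - (1 / d c - 1 / d R))" if "c \<le> R" for R
  proof -
    have "integral {0..R} f = integral {0..c} f + integral {c..R} f"
      using that c fI by (simp add: Henstock_Kurzweil_Integration.integral_combine)
    moreover have "integral {c..R} f = (H R - H c) + integral {c..R} k"
      using integral_unique[OF FH[OF order_refl that]] integral_diff[OF fI kI[OF order_refl that]] c by simp
    moreover have "integral {c..R} g = integral {c..R} k + (1 / d c - 1 / d R)"
      unfolding g_def using integral_unique[OF FD[OF order_refl that]]
        integral_add[OF kI[OF order_refl that] has_integral_integrable[OF FD[OF order_refl that]]] by simp
    ultimately show ?thesis by simp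
  qed
  have "((\<lambda>R. integral {0..c} f + (H R - H c) + (integral {c..R} g - (1 / d c - 1 / d R)))
      \<longlongrightarrow> integral {0..c} f + (0 - H c) + ((SUP R\<in>{c..}. integral {c..R} g) - (1 / d c - 0))) at_top"
    by (intro tendsto_intros limH limg lim_d)
  moreover have "\<forall>\<^sub>F R in at_top. integral {0..c} f + (H R - H c)
      + (integral {c..R} g - (1 / d c - 1 / d R)) = integral {0..R} f"
    using eventually_ge_at_top[of c] by eventually_elim (rule eq[symmetric])
  ultimately have "((\<lambda>R. integral {0..R} f) \<longlongrightarrow>
      integral {0..c} f + (0 - H c) + ((SUP R\<in>{c..}. integral {c..R} g) - (1 / d c - 0))) at_top"
    by (rule Lim_transform_eventually)
  thus ?thesis unfolding f_def p_def by blast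
qed

end

theory Submission
  imports Defs "HOL-Complex_Analysis.Complex_Analysis"
begin

text \<open>
  The sum \<open>Ai_n(y) + Ai_n(- y)\<close> is \<open>2 / \<pi>\<close> times the real part of the integral of
  \<open>cos (z y) exp (i z\<^sup>n / n)\<close> over the positive half-line. Rotating the half-line to the ray
  \<open>z = r w\<close> with \<open>w = exp (i \<pi> / (2 n))\<close>, so that \<open>w\<^sup>n = i\<close>, turns the oscillating exponential
  into \<open>exp (- r\<^sup>n / n)\<close>. Integration by parts against \<open>sin (z y) / y\<close> then produces the weight
  \<open>r\<^sup>n\<^sup>-\<^sup>1 exp (- r\<^sup>n / n)\<close>, a rescaled Weibull density, and the real part of \<open>sin (r w y)\<close> is
  \<open>sin (r y cos \<theta>) cosh (r y sin \<theta>)\<close> with \<open>\<theta> = \<pi> / (2 n)\<close>. Since the kernel is entire, the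
  rotation is carried out by comparing values of a primitive.
\<close>

section \<open>Elementary growth and decay estimates\<close>

text \<open>A Jordan-type inequality with 1/2 in place of 2/pi; it makes the decay on the arc linear
  in the angle. The mean value theorem and the monotonicity of \<open>cos\<close> give (x/2) cos
  (x/2) <= sin (x/2); multiplying by 2 cos (x/2) turns this into x (1 + cos x) / 2 <= sin x.\<close>

lemma half_le_sin:
  fixes x :: real
  assumes "0 \<le> x" "x \<le> pi / 2"
  shows "x / 2 \<le> sin x"
proof (cases "x = 0")
  case False
  then have "0 < x / 2" using assms by simp
  from MVT2[OF this, of sin cos] obtain z
    where z: "0 < z" "z < x / 2" "sin (x / 2) = x / 2 * cos z"
    by (auto intro: derivative_eq_intros)
  have c: "0 \<le> cos (x / 2)" using assms by (intro cos_ge_zero) auto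
  have "cos (x / 2) \<le> cos z" using z assms by (intro cos_monotone_0_pi_le) auto
  then have "x / 2 * cos (x / 2) \<le> sin (x / 2)"
    using assms z by (simp add: mult_left_mono)
  then have "2 * (x / 2 * cos (x / 2)) * cos (x / 2) \<le> 2 * sin (x / 2) * cos (x / 2)"
    using c by (simp add: mult_right_mono)
  also have "\<dots> = sin x" using sin_double[of "x / 2"] by simp
  also have "2 * (x / 2 * cos (x / 2)) * cos (x / 2) = x * (1 + cos x) / 2"
    using cos_double_cos[of "x / 2"] by (simp add: power2_eq_square algebra_simps)
  finally have "x * (1 + cos x) / 2 \<le> sin x" .
  moreover have "0 \<le> cos x" using assms by (intro cos_ge_zero) auto
  then have "0 \<le> x * cos x" using assms by simp
  ultimately show ?thesis by (simp add: algebra_simps)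
qed simp

text \<open>Growth is governed by the imaginary part alone, so at angle \<open>phi\<close> on the
  circle of radius \<open>R\<close> the cosine factor of the kernel costs at most exp (R |y|
  phi).\<close>

lemma norm_cos_le_exp_Im: "norm (cos z) \<le> exp \<bar>Im z\<bar>" for z :: complex
proof -
  have "norm (cos z) \<le> (norm (exp (\<i> * z)) + norm (exp (- (\<i> * z)))) / 2"
    using norm_triangle_ineq[of "exp (\<i> * z)" "exp (- (\<i> * z))"]
    unfolding cos_exp_eq by (simp add: norm_divide)
  also have "\<dots> \<le> (exp \<bar>Im z\<bar> + exp \<bar>Im z\<bar>) / 2"
    by (intro divide_right_mono add_mono) auto
  finally show ?thesis by simp
qed

lemma norm_sin_le_exp_Im: "norm (sin z) \<le> exp \<bar>Im z\<bar>" for z :: complex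
proof -
  have "norm (sin z) \<le> (norm (exp (\<i> * z)) + norm (exp (- (\<i> * z)))) / 2"
    using norm_triangle_ineq4[of "exp (\<i> * z)" "exp (- (\<i> * z))"]
    unfolding sin_exp_eq by (simp add: norm_divide norm_mult)
  also have "\<dots> \<le> (exp \<bar>Im z\<bar> + exp \<bar>Im z\<bar>) / 2"
    by (intro divide_right_mono add_mono) auto
  finally show ?thesis by simp
qed

lemma Re_sin: "Re (sin z) = sin (Re z) * cosh (Im z)"
  by (simp add: sin_exp_eq cosh_def Re_divide Im_exp Re_exp algebra_simps add_divide_distrib)

text \<open>Lets one Gaussian bound serve all \<open>n\<close>. The -1 takes care of r < 1, where
  r^n may drop below r^2 but r^2 - 1 is not positive.\<close>

lemma power_ge_square_minus_one:
  fixes r :: real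
  assumes "2 \<le> n" "0 \<le> r"
  shows "r\<^sup>2 - 1 \<le> r ^ n"
proof (cases "1 \<le> r")
  case True
  then have "r\<^sup>2 \<le> r ^ n" using assms by (intro power_increasing) auto
  then show ?thesis by simp
next
  case False
  then have "r\<^sup>2 \<le> 1" using assms by (simp add: power_le_one)
  then show ?thesis using assms by (smt (verit) zero_le_power)
qed

section \<open>The entire kernel and its arc estimate\<close>

definition airy_kernel :: "nat \<Rightarrow> real \<Rightarrow> complex \<Rightarrow> complex" where
  "airy_kernel n y z = cos (z * of_real y) * exp (\<i> * z ^ n / of_nat n)"

lemma airy_kernel_primitive:
  obtains P where "\<And>z. (P has_field_derivative airy_kernel n y z) (at z)"
proof -
  have "airy_kernel n y holomorphic_on UNIV"
    unfolding airy_kernel_def divide_inverse by (intro holomorphic_intros)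
  then show ?thesis
    using holomorphic_convex_primitive'[of UNIV "airy_kernel n y"] that by auto
qed

text \<open>On the arc of radius \<open>R\<close> the kernel is at most \<open>exp (- D \<phi>)\<close> with \<open>D\<close> of order \<open>R\<^sup>2\<close>, so
  the arc contributes at most \<open>R / D\<close>.\<close>

lemma airy_kernel_arc_tendsto:
  assumes n: "2 \<le> n" and P: "\<And>z. (P has_field_derivative airy_kernel n y z) (at z)"
  shows "((\<lambda>R. P (of_real R * cis (pi / (2 * real n))) - P (of_real R)) \<longlongrightarrow> 0) at_top"
proof -
  define \<theta> where "\<theta> = pi / (2 * real n)"
  have \<theta>: "0 < \<theta>" "real n * \<theta> = pi / 2" using n by (auto simp: \<theta>_def)
  \<comment> \<open>The term R^2 / 2 combines R^n >= R^2 with sin (n phi) / n >= phi / 2; the term R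
    |y| is the growth of the cosine factor.\<close>
  define D where "D = (\<lambda>R. R\<^sup>2 / 2 - R * \<bar>y\<bar>)"
  have bound: "norm (P (of_real R * cis \<theta>) - P (of_real R)) \<le> R / D R"
    if R: "1 \<le> R" "0 < D R" for R
  proof -
    have kernel: "norm (airy_kernel n y (of_real R * cis \<phi>)) \<le> exp (- D R * \<phi>)"
      if \<phi>: "0 < \<phi>" "\<phi> < \<theta>" for \<phi>
    proof -
      have "real n * \<phi> \<le> pi / 2" using \<phi> \<theta> n by (metis less_imp_le mult_left_mono of_nat_0_le_iff)
      then have s: "real n * \<phi> / 2 \<le> sin (real n * \<phi>)" using \<phi> by (intro half_le_sin) auto
      have "R\<^sup>2 * \<phi> / 2 \<le> R ^ n * \<phi> / 2"
        using R n \<phi> by (intro divide_right_mono mult_right_mono power_increasing) auto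
      also have "\<dots> = R ^ n * (real n * \<phi> / 2) / real n" using n by simp
      also have "\<dots> \<le> R ^ n * sin (real n * \<phi>) / real n"
        using R s by (intro divide_right_mono mult_left_mono) auto
      finally have 1: "R\<^sup>2 * \<phi> / 2 \<le> R ^ n * sin (real n * \<phi>) / real n" .
      have ray: "\<i> * (of_real R * cis \<phi>) ^ n / of_nat n
          = of_real (R ^ n / real n) * (\<i> * cis (real n * \<phi>))"
        by (simp add: power_mult_distrib Complex.DeMoivre)
      have Re_ray: "Re (of_real a * (\<i> * cis b)) = - (a * sin b)" for a b by simp
      have 2: "Re (\<i> * (of_real R * cis \<phi>) ^ n / of_nat n) = - (R ^ n * sin (real n * \<phi>) / real n)"
        unfolding ray Re_ray by (rule arg_cong[where f = uminus]) (rule times_divide_eq_left)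
      have 3: "\<bar>Im (of_real R * cis \<phi> * of_real y)\<bar> \<le> R * \<bar>y\<bar> * \<phi>"
      proof -
        have "\<bar>Im (of_real R * cis \<phi> * of_real y)\<bar> = R * \<bar>y\<bar> * \<bar>sin \<phi>\<bar>"
          using R by (simp add: abs_mult)
        also have "\<dots> \<le> R * \<bar>y\<bar> * \<phi>"
          using R \<phi> abs_sin_x_le_abs_x[of \<phi>] by (intro mult_left_mono) auto
        finally show ?thesis .
      qed
      have "norm (airy_kernel n y (of_real R * cis \<phi>))
          \<le> exp (R * \<bar>y\<bar> * \<phi>) * exp (- (R\<^sup>2 * \<phi> / 2))"
        unfolding airy_kernel_def norm_mult norm_exp_eq_Re 2
        using 1 3 by (intro mult_mono order.trans[OF norm_cos_le_exp_Im]) auto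
      also have "\<dots> = exp (- D R * \<phi>)"
        by (simp add: D_def exp_add[symmetric] algebra_simps)
      finally show ?thesis .
    qed
    \<comment> \<open>The speed of the arc is \<open>R\<close>, so its derivative is bounded by R
      exp (- D phi), which is itself the derivative of -(R / D) exp (- D phi). Comparing increments
      over the arc gives (R / D) (1 - exp (- D \<theta>)).\<close>
    have "norm (P (of_real R * cis \<theta>) - P (of_real R * cis 0))
        \<le> - (R / D R) * exp (- D R * \<theta>) - (- (R / D R) * exp (- D R * 0))"
    proof (rule differentiable_bound_general[where
          f' = "\<lambda>\<phi>. of_real R * \<i> * cis \<phi> * airy_kernel n y (of_real R * cis \<phi>)"
          and \<phi>' = "\<lambda>\<phi>. R * exp (- D R * \<phi>)" and \<phi> = "\<lambda>\<phi>. - (R / D R) * exp (- D R * \<phi>)"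
          and f = "\<lambda>\<phi>. P (of_real R * cis \<phi>)"])
      show "0 < \<theta>" by (rule \<theta>)
      have der: "((\<lambda>\<phi>. P (of_real R * cis \<phi>)) has_vector_derivative
          of_real R * \<i> * cis \<phi> * airy_kernel n y (of_real R * cis \<phi>)) (at \<phi>)" for \<phi>
      proof -
        have "((\<lambda>\<phi>. of_real R * cis \<phi>) has_vector_derivative of_real R * \<i> * cis \<phi>) (at \<phi>)"
          unfolding cis_conv_exp
          by (auto intro!: derivative_eq_intros has_vector_derivative_real_field)
        from field_vector_diff_chain_at[OF this P]
        show ?thesis by (simp add: o_def mult_ac)
      qed
      show "((\<lambda>\<phi>. P (of_real R * cis \<phi>)) has_vector_derivative
          of_real R * \<i> * cis \<phi> * airy_kernel n y (of_real R * cis \<phi>)) (at \<phi>)" for \<phi>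
        by (rule der)
      show "continuous_on {0..\<theta>} (\<lambda>\<phi>. P (of_real R * cis \<phi>))"
        using der by (intro continuous_at_imp_continuous_on ballI has_vector_derivative_continuous)
      show "continuous_on {0..\<theta>} (\<lambda>\<phi>. - (R / D R) * exp (- D R * \<phi>))"
        by (intro continuous_intros)
      show "((\<lambda>\<phi>. - (R / D R) * exp (- D R * \<phi>)) has_vector_derivative R * exp (- D R * \<phi>)) (at \<phi>)" for \<phi>
        unfolding has_real_derivative_iff_has_vector_derivative[symmetric]
        using R by (auto intro!: derivative_eq_intros)
      show "norm (of_real R * \<i> * cis \<phi> * airy_kernel n y (of_real R * cis \<phi>)) \<le> R * exp (- D R * \<phi>)"
        if "0 < \<phi>" "\<phi> < \<theta>" for \<phi>
        using R kernel[OF that] by (simp add: norm_mult mult_left_mono)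
    qed
    also have "\<dots> \<le> R / D R" using R by simp
    finally show ?thesis by simp
  qed
  have "((\<lambda>R. R / D R) \<longlongrightarrow> 0) at_top" unfolding D_def by real_asymp
  moreover have "\<forall>\<^sub>F R in at_top. 0 < D R" unfolding D_def by real_asymp
  then have "\<forall>\<^sub>F R in at_top. norm (P (of_real R * cis \<theta>) - P (of_real R)) \<le> R / D R"
    using eventually_ge_at_top[of 1] by eventually_elim (rule bound)
  ultimately show ?thesis
    unfolding \<theta>_def[symmetric] by (rule Lim_null_comparison[rotated])
qed

section \<open>Airy functions as limits along the real axis\<close>

text \<open>\<open>Lim\<close> is informative only when a limit exists;
  \<open>Ai_gen_convergent\<close> supplies existence, and uniqueness of limits identifies the
  value.\<close>

lemma Ai_gen_tendsto:
  assumes "1 < \<alpha>"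
  shows "((\<lambda>R. integral {0..R} (\<lambda>s. cos (s * x + s powr \<alpha> / \<alpha>))) \<longlongrightarrow> pi * Ai_gen \<alpha> x) at_top"
proof -
  obtain L where L: "((\<lambda>R. integral {0..R} (\<lambda>s. cos (s * x + s powr \<alpha> / \<alpha>))) \<longlongrightarrow> L) at_top"
    using Ai_gen_convergent[OF assms] by blast
  then have "pi * Ai_gen \<alpha> x = L" by (simp add: Ai_gen_def tendsto_Lim)
  then show ?thesis using L by simp
qed

text \<open>The addition formulas: cos (s y) cos (s^n / n) is half the sum of the cosines of s^n / n
  + s y and s^n / n - s y. Symmetrising in \<open>y\<close> is what makes the integrand
  factor.\<close>

lemma Re_airy_kernel_of_real:
  assumes "0 < n" "0 \<le> s"
  shows "Re (airy_kernel n y (of_real s)) =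
    (cos (s * y + s powr real n / real n) + cos (s * - y + s powr real n / real n)) / 2"
proof -
  \<comment> \<open>At s = 0 both sides vanish: \<open>0 powr\<close> anything is 0, and
    \<open>0 ^ n\<close> is 0 because \<open>n\<close> is positive.\<close>
  have p: "s powr real n = s ^ n" using assms by (cases "s = 0") (auto simp: powr_realpow)
  have "airy_kernel n y (of_real s) = of_real (cos (s * y)) * cis (s ^ n / real n)"
    by (simp add: airy_kernel_def cis_conv_exp cos_of_real[symmetric])
  then show ?thesis by (simp add: p cos_add cos_diff)
qed

text \<open>The increment of \<open>P\<close> over the segment from 0 to \<open>R\<close> is the
  integral of the kernel. The factor pi / 2 joins the half from the addition formulas with the
  normalisation 1 / pi of \<open>Ai_gen\<close>.\<close>

lemma Ai_gen_symm_tendsto: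
  assumes n: "2 \<le> n" and P: "\<And>z. (P has_field_derivative airy_kernel n y z) (at z)"
  shows "((\<lambda>R. Re (P (of_real R) - P 0)) \<longlongrightarrow>
    pi / 2 * (Ai_gen (real n) y + Ai_gen (real n) (- y))) at_top"
proof -
  let ?f = "\<lambda>x s. cos (s * x + s powr real n / real n)"
  have *: "Re (P (of_real R) - P 0) = (integral {0..R} (?f y) + integral {0..R} (?f (- y))) / 2"
    if R: "0 \<le> R" for R
  proof -
    have "((\<lambda>s. P (of_real s)) has_vector_derivative airy_kernel n y (of_real s)) (at s within A)" for s A
      using has_vector_derivative_real_field[OF P] by (rule has_vector_derivative_at_within)
    then have "((\<lambda>s. airy_kernel n y (of_real s)) has_integral P (of_real R) - P (of_real 0)) {0..R}"
      using R by (intro fundamental_theorem_of_calculus) auto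
    from has_integral_Re[OF this]
    have 1: "((\<lambda>s. (?f y s + ?f (- y) s) / 2) has_integral Re (P (of_real R) - P 0)) {0..R}"
      using n by (subst has_integral_cong[OF Re_airy_kernel_of_real[symmetric]]) auto
    have i: "?f x integrable_on {0..R}" for x
      using n by (intro integrable_continuous_interval continuous_on_powr' continuous_intros) auto
    have "((\<lambda>s. (?f y s + ?f (- y) s) / 2) has_integral
        (integral {0..R} (?f y) + integral {0..R} (?f (- y))) / 2) {0..R}"
      by (intro has_integral_divide has_integral_add integrable_integral i)
    with 1 show ?thesis by (rule has_integral_unique)
  qed
  have "((\<lambda>R. (integral {0..R} (?f y) + integral {0..R} (?f (- y))) / 2) \<longlongrightarrow>
      (pi * Ai_gen (real n) y + pi * Ai_gen (real n) (- y)) / 2) at_top"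
    using n by (intro tendsto_intros Ai_gen_tendsto) auto
  moreover have "\<forall>\<^sub>F R in at_top. (integral {0..R} (?f y) + integral {0..R} (?f (- y))) / 2
      = Re (P (of_real R) - P 0)"
    using eventually_ge_at_top[of 0] by eventually_elim (simp only: *)
  ultimately show ?thesis
    by (rule Lim_transform_eventually[THEN tendsto_eq_rhs]) (simp add: field_simps)
qed

section \<open>Integration by parts on the rotated ray\<close>

lemma Ai_gen_symm_ray_tendsto:
  fixes y :: real
  assumes n: "2 \<le> n" and y: "y \<noteq> 0"
  defines "\<theta> \<equiv> pi / (2 * real n)"
  shows "((\<lambda>R. integral {0..R} (\<lambda>r. sin (cos \<theta> * y * r) * cosh (sin \<theta> * y * r)
      * r ^ (n - 1) * exp (- (r ^ n / real n)))) \<longlongrightarrow>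
    pi * y / 2 * (Ai_gen (real n) y + Ai_gen (real n) (- y))) at_top"
proof -
  obtain P where P: "\<And>z. (P has_field_derivative airy_kernel n y z) (at z)"
    using airy_kernel_primitive[of n y] by metis
  define w where "w = cis \<theta>"
  have wn: "w ^ n = \<i>" using n by (simp add: w_def \<theta>_def Complex.DeMoivre)
  define E where "E = (\<lambda>z. exp (\<i> * z ^ n / of_nat n) :: complex)"
  \<comment> \<open>Integration by parts in primitive form: differentiating, y cos (z y)
    \<open>E\<close> cancels and only -sin (z y) times the derivative of \<open>E\<close> remains,
    which is \<open>k\<close>. The constant \<open>P 0\<close> makes \<open>K\<close> vanish at the
    origin.\<close>
  define K where "K = (\<lambda>z. of_real y * (P z - P 0) - sin (z * of_real y) * E z)"
  define k where "k = (\<lambda>z. - (\<i> * z ^ (n - 1) * sin (z * of_real y) * E z))"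
  have K': "(K has_field_derivative k z) (at z)" for z
  proof -
    have "(E has_field_derivative \<i> * z ^ (n - 1) * E z) (at z)"
      unfolding E_def using n by (auto intro!: derivative_eq_intros)
    note E' = this
    have kernel: "airy_kernel n y z = cos (z * of_real y) * E z"
      by (simp add: airy_kernel_def E_def)
    show ?thesis
      unfolding K_def k_def
      by (rule derivative_eq_intros P E' refl)+ (simp add: kernel algebra_simps)
  qed
  have Ew: "E (of_real r * w) = of_real (exp (- (r ^ n / real n)))" for r
  proof -
    have "\<i> * (of_real r * w) ^ n / of_nat n = of_real (- (r ^ n / real n))"
      by (simp add: power_mult_distrib wn mult.left_commute[of \<i>])
    then show ?thesis unfolding E_def by (simp only: exp_of_real)
  qed
  \<comment> \<open>The factor \<open>w\<close> from parametrising the ray completes w^(n - 1) to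
    w^n = i, and -i * i = 1. Only the sine is left complex, so taking real parts is
    immediate.\<close>
  have w_k: "w * k (of_real r * w) = sin (of_real r * w * of_real y)
      * of_real (r ^ (n - 1) * exp (- (r ^ n / real n)))" for r
  proof -
    have "w * w ^ (n - 1) = \<i>" using wn n by (simp add: power_eq_if split: if_splits)
    then have *: "- (\<i> * (w * w ^ (n - 1))) = 1" by simp
    have "w * k (of_real r * w) = - (\<i> * (w * w ^ (n - 1))) *
        (sin (of_real r * w * of_real y) * (of_real (r ^ (n - 1)) * E (of_real r * w)))"
      by (simp add: k_def power_mult_distrib mult_ac)
    then show ?thesis unfolding * Ew by simp
  qed
  have Re_k: "Re (w * k (of_real r * w)) = sin (cos \<theta> * y * r) * cosh (sin \<theta> * y * r)
      * r ^ (n - 1) * exp (- (r ^ n / real n))" for r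
  proof -
    have "Re (sin (of_real r * w * of_real y)) = sin (cos \<theta> * y * r) * cosh (sin \<theta> * y * r)"
      unfolding Re_sin by (simp add: w_def mult_ac)
    then show ?thesis unfolding w_k by simp
  qed
  have "Re (K (of_real R * w)) = integral {0..R} (\<lambda>r. sin (cos \<theta> * y * r) * cosh (sin \<theta> * y * r)
      * r ^ (n - 1) * exp (- (r ^ n / real n)))" if R: "0 \<le> R" for R
  proof -
    have "((\<lambda>r. K (of_real r * w)) has_vector_derivative w * k (of_real r * w)) (at r within A)" for r A
    proof -
      have "((\<lambda>r. of_real r * w) has_vector_derivative w) (at r)"
        by (auto intro!: derivative_eq_intros)
      from has_vector_derivative_at_within[OF field_vector_diff_chain_at[OF this K']]
      show ?thesis by (simp add: o_def)
    qed
    then have "((\<lambda>r. w * k (of_real r * w)) has_integral K (of_real R * w) - K (of_real 0 * w)) {0..R}"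
      using R by (intro fundamental_theorem_of_calculus) auto
    moreover have "K (of_real 0 * w) = 0" by (simp add: K_def)
    ultimately have "((\<lambda>r. w * k (of_real r * w)) has_integral K (of_real R * w)) {0..R}" by simp
    from has_integral_Re[OF this, unfolded Re_k] show ?thesis
      by (rule integral_unique[symmetric])
  qed
  then have ev: "\<forall>\<^sub>F R in at_top. Re (K (of_real R * w)) = integral {0..R} (\<lambda>r. sin (cos \<theta> * y * r)
      * cosh (sin \<theta> * y * r) * r ^ (n - 1) * exp (- (r ^ n / real n)))"
    by (rule eventually_mono[OF eventually_ge_at_top])
  \<comment> \<open>The boundary term dies: the sine grows at most like exp (R |y|), while
    \<open>E\<close> decays on the ray like exp (- R^n / n), hence at least as fast as a
    Gaussian.\<close>
  have Q: "((\<lambda>R. sin (of_real R * w * of_real y) * E (of_real R * w)) \<longlongrightarrow> 0) at_top"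
  proof (rule Lim_null_comparison)
    have "real n > 0" using n by simp
    then show "((\<lambda>R. exp (R * \<bar>y\<bar> - (R\<^sup>2 - 1) / real n)) \<longlongrightarrow> 0) at_top" by real_asymp
    show "\<forall>\<^sub>F R in at_top. norm (sin (of_real R * w * of_real y) * E (of_real R * w))
        \<le> exp (R * \<bar>y\<bar> - (R\<^sup>2 - 1) / real n)"
      using eventually_ge_at_top[of 0]
    proof eventually_elim
      case (elim R)
      have "\<bar>Im (of_real R * w * of_real y)\<bar> = R * \<bar>y\<bar> * \<bar>sin \<theta>\<bar>"
        using elim by (simp add: w_def abs_mult)
      also have "\<dots> \<le> R * \<bar>y\<bar>" using elim by (simp add: mult_left_le)
      finally have 1: "\<bar>Im (of_real R * w * of_real y)\<bar> \<le> R * \<bar>y\<bar>" .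
      have 2: "(R\<^sup>2 - 1) / real n \<le> R ^ n / real n"
        using power_ge_square_minus_one[OF n elim] by (intro divide_right_mono) auto
      have "norm (sin (of_real R * w * of_real y) * E (of_real R * w))
          \<le> exp (R * \<bar>y\<bar>) * exp (- ((R\<^sup>2 - 1) / real n))"
        unfolding norm_mult Ew using 1 2
        by (intro mult_mono order.trans[OF norm_sin_le_exp_Im]) auto
      then show ?case by (simp add: exp_add[symmetric])
    qed
  qed
  \<comment> \<open>\<open>K\<close> at the end of the ray splits into the arc increment, the
    real-axis increment and the boundary term; only the real-axis increment has a contribution in
    the limit.\<close>
  have "((\<lambda>R. y * Re (P (of_real R * w) - P (of_real R)) + y * Re (P (of_real R) - P 0)
        - Re (sin (of_real R * w * of_real y) * E (of_real R * w))) \<longlongrightarrow>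
      y * Re 0 + y * (pi / 2 * (Ai_gen (real n) y + Ai_gen (real n) (- y))) - Re 0) at_top"
    unfolding w_def \<theta>_def
    by (intro tendsto_diff[OF tendsto_add] tendsto_mult_left tendsto_Re Q[unfolded w_def \<theta>_def]
        airy_kernel_arc_tendsto[OF n P] Ai_gen_symm_tendsto[OF n P])
  then have "((\<lambda>R. Re (K (of_real R * w))) \<longlongrightarrow>
      pi * y / 2 * (Ai_gen (real n) y + Ai_gen (real n) (- y))) at_top"
    by (simp add: K_def algebra_simps)
  then show ?thesis using ev by (rule Lim_transform_eventually)
qed

section \<open>The Weibull density and integrability\<close>

text \<open>Passes from real to natural powers. The formula extends to g = 0, where the density is 0
  by definition, because n - 1 >= 1 makes the right-hand side vanish too.\<close>

lemma weibull_density_inverse: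
  assumes "2 \<le> n" "0 \<le> g"
  shows "weibull_density (real n) (1 / t) g = real n * t * g ^ (n - 1) * exp (- (t * g ^ n))"
proof (cases "g = 0")
  case False
  then have "g powr (real n - 1) = g ^ (n - 1)" "g powr real n = g ^ n"
    using assms powr_realpow[of g n] powr_realpow[of g "n - 1"] by (auto simp: of_nat_diff)
  then show ?thesis using assms False by (simp add: weibull_density_def mult_ac)
qed (use assms in \<open>simp add: weibull_density_def\<close>)

lemma weibull_density_nonneg: "0 < t \<Longrightarrow> 0 \<le> weibull_density (real n) (1 / t) g"
  by (simp add: weibull_density_def)

lemma weibull_density_measurable [measurable]: "weibull_density \<gamma> \<tau> \<in> borel_measurable borel"
  unfolding weibull_density_def by measurable

text \<open>Bounding g^(n - 1) by exp ((n - 1) g) and g^n from below by g^2 - 1 leaves a quadratic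
  exponent, whose maximum is found by completing the square.\<close>

lemma weibull_density_exp_bound:
  assumes n: "2 \<le> n" and t: "0 < t"
  obtains C where "\<And>g. 0 \<le> g \<Longrightarrow> weibull_density (real n) (1 / t) g * exp (b * g) \<le> C * exp (- g)"
proof
  \<comment> \<open>The linear terms add up to (n - 1 + b) g = B g - g; the reserved - g is the
    decay that survives.\<close>
  define B where "B = real n + b"
  fix g :: real assume g: "0 \<le> g"
  have "g \<le> exp g" using exp_ge_add_one_self[of g] by linarith
  then have "g ^ (n - 1) \<le> exp g ^ (n - 1)" using g by (intro power_mono)
  also have "\<dots> = exp (real (n - 1) * g)" by (simp add: exp_of_nat_mult)
  finally have 1: "g ^ (n - 1) \<le> exp (real (n - 1) * g)" .
  have "t * (g\<^sup>2 - 1) \<le> t * g ^ n" using power_ge_square_minus_one[OF n g] t by simp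
  moreover have "B * g - t * g\<^sup>2 \<le> B\<^sup>2 / (4 * t)"
  proof -
    have "0 \<le> (2 * t * g - B)\<^sup>2 / (4 * t)" using t by simp
    also have "\<dots> = B\<^sup>2 / (4 * t) - (B * g - t * g\<^sup>2)"
      using t by (simp add: field_simps power2_eq_square)
    finally show ?thesis by simp
  qed
  moreover have "real (n - 1) * g = real n * g - g" using n by (simp add: of_nat_diff algebra_simps)
  ultimately have 2: "real (n - 1) * g + - (t * g ^ n) + b * g \<le> t + B\<^sup>2 / (4 * t) + - g"
    by (simp add: B_def algebra_simps)
  have "weibull_density (real n) (1 / t) g * exp (b * g)
      = real n * t * (g ^ (n - 1) * exp (- (t * g ^ n)) * exp (b * g))"
    using weibull_density_inverse[OF n g] by simp
  also have "\<dots> \<le> real n * t * (exp (real (n - 1) * g) * exp (- (t * g ^ n)) * exp (b * g))"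
    using 1 t by (intro mult_left_mono mult_right_mono) auto
  also have "\<dots> = real n * t * exp (real (n - 1) * g + - (t * g ^ n) + b * g)"
    by (simp only: exp_add)
  also have "\<dots> \<le> real n * t * exp (t + B\<^sup>2 / (4 * t) + - g)"
    using 2 t by (intro mult_left_mono) auto
  also have "\<dots> = real n * t * exp (t + B\<^sup>2 / (4 * t)) * exp (- g)"
    by (simp only: exp_add mult.assoc)
  finally show "weibull_density (real n) (1 / t) g * exp (b * g)
      \<le> real n * t * exp (t + B\<^sup>2 / (4 * t)) * exp (- g)" .
qed

lemma cosh_le_exp_abs: "cosh x \<le> exp \<bar>x\<bar>" for x :: real
  by (simp add: cosh_def field_simps abs_if)

text \<open>Domination by \<open>C\<close> exp (- g) on the half-line. This yields the existence of
  the expectation and also identifies it with a limit of truncated integrals.\<close>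

lemma integrable_weibull_density_sin_cosh:
  assumes n: "2 \<le> n" and t: "0 < t"
  shows "integrable lborel (\<lambda>g. weibull_density (real n) (1 / t) g * (sin (a * g) * cosh (b * g)))"
proof -
  obtain C where C: "\<And>g. 0 \<le> g \<Longrightarrow> weibull_density (real n) (1 / t) g * exp (\<bar>b\<bar> * g) \<le> C * exp (- g)"
    using weibull_density_exp_bound[OF n t] by blast
  \<comment> \<open>Gauge integrability of a nonnegative function is absolute integrability for
    \<open>lebesgue\<close>; Borel measurability then brings it down to
    \<open>lborel\<close>.\<close>
  have "set_integrable lebesgue {0..} (\<lambda>g. exp (- 1 * g) :: real)"
    by (intro nonnegative_absolutely_integrable_1 integrable_on_exp_minus_to_infinity) auto
  then have "set_integrable lborel {0..} (\<lambda>g. exp (- 1 * g) :: real)"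
    unfolding set_integrable_def by (subst (asm) integrable_completion) auto
  then have "integrable lborel (\<lambda>g. C * (indicator {0..} g * exp (- g)) :: real)"
    by (simp add: set_integrable_def)
  then show ?thesis
  proof (rule Bochner_Integration.integrable_bound)
    show "AE g in lborel. norm (weibull_density (real n) (1 / t) g * (sin (a * g) * cosh (b * g)))
        \<le> norm (C * (indicator {0..} g * exp (- g)))"
    proof (rule AE_I2)
      fix g :: real
      show "norm (weibull_density (real n) (1 / t) g * (sin (a * g) * cosh (b * g)))
          \<le> norm (C * (indicator {0..} g * exp (- g)))"
      proof (cases "0 \<le> g")
        case True
        have "norm (sin (a * g) * cosh (b * g)) \<le> 1 * exp (\<bar>b\<bar> * g)"
          unfolding norm_mult using True cosh_le_exp_abs[of "b * g"]
          by (intro mult_mono) (auto simp: abs_mult)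
        then have "norm (weibull_density (real n) (1 / t) g * (sin (a * g) * cosh (b * g)))
            \<le> weibull_density (real n) (1 / t) g * exp (\<bar>b\<bar> * g)"
          unfolding norm_mult using weibull_density_nonneg[OF t] by (intro mult_mono) auto
        also have "\<dots> \<le> norm (C * (indicator {0..} g * exp (- g)))"
          using C[OF True] True by simp
        finally show ?thesis .
      qed (simp add: weibull_density_def)
    qed
  qed (unfold cosh_def, measurable)
qed

section \<open>Rescaling to the expectation\<close>

theorem theorem2:
  fixes n :: nat and x t :: real and M :: "'a measure" and G :: "'a \<Rightarrow> real"
  assumes "2 \<le> n" and "x \<noteq> 0" and "0 < t"
    and "prob_space M"
    and "distributed M lborel G (\<lambda>y. ennreal (weibull_density (real n) (1 / t) y))"
  shows "integrable M (\<lambda>\<omega>. sin (cos (pi / (2 * real n)) * x * G \<omega>) *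
                            cosh (sin (pi / (2 * real n)) * x * G \<omega>)) \<and>
         u_even n x t =
           1 / (pi * x) *
             prob_space.expectation M
               (\<lambda>\<omega>. sin (cos (pi / (2 * real n)) * x * G \<omega>) *
                     cosh (sin (pi / (2 * real n)) * x * G \<omega>))"
proof -
  note n = assms(1) and x = assms(2) and t = assms(3) and G = assms(5)
  define \<theta> where "\<theta> = pi / (2 * real n)"
  define f where "f = (\<lambda>g. sin (cos \<theta> * x * g) * cosh (sin \<theta> * x * g))"
  define h where "h = (\<lambda>g. weibull_density (real n) (1 / t) g * f g)"
  have f_meas: "f \<in> borel_measurable lborel" unfolding f_def cosh_def by measurable
  have int: "integrable lborel h"
    unfolding h_def f_def by (rule integrable_weibull_density_sin_cosh[OF n t])
  have "integrable M (\<lambda>\<omega>. f (G \<omega>))"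
    using distributed_integrable[OF G f_meas weibull_density_nonneg[OF t]] int by (simp add: h_def)
  moreover have "u_even n x t = 1 / (pi * x) * (\<integral>\<omega>. f (G \<omega>) \<partial>M)"
  proof -
    \<comment> \<open>The substitution is r = c g. Since c^n = n t, it turns r^n / n into t g^n, the
      exponent of the density with parameter 1 / t.\<close>
    define c where "c = (real n * t) powr (1 / real n)"
    have c: "0 < c" using n t by (simp add: c_def)
    have cn: "c ^ n = real n * t"
      using c n t by (simp add: c_def powr_realpow[symmetric] powr_powr)
    define y where "y = x / c"
    have y: "y \<noteq> 0" "y * c = x" using x c by (auto simp: y_def)
    define k where "k = (\<lambda>r. sin (cos \<theta> * y * r) * cosh (sin \<theta> * y * r) * r ^ (n - 1)
      * exp (- (r ^ n / real n)))"
    \<comment> \<open>The Jacobian \<open>c\<close> joins c^(n - 1) to give c^n = n t, exactly the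
      constant factor of the density.\<close>
    have h_k: "h g = c * k (c * g)" if "0 \<le> g" for g
    proof -
      have "a * y * (c * g) = a * x * g" for a using y(2) by (simp add: mult_ac)
      from this[of "cos \<theta>"] this[of "sin \<theta>"]
      have "c * k (c * g) = f g * (c * c ^ (n - 1)) * g ^ (n - 1) * exp (- ((c * g) ^ n / real n))"
        unfolding k_def f_def by (simp only: power_mult_distrib[of c g "n - 1"]) (simp only: mult_ac)
      also have "c * c ^ (n - 1) = real n * t" using cn n by (simp add: power_eq_if split: if_splits)
      also have "(c * g) ^ n / real n = t * g ^ n" using n by (simp add: power_mult_distrib cn)
      finally show ?thesis
        by (simp add: h_def weibull_density_inverse[OF n that] mult_ac)
    qed
    have scale: "integral {0..R} h = integral {0..c * R} k" if R: "0 \<le> R" for R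
    proof -
      have "k integrable_on {0..c * R}"
        unfolding k_def cosh_def by (intro integrable_continuous_interval continuous_intros) (use n in auto)
      from has_integral_affinity'[OF integrable_integral[OF this, unfolded interval_cbox] c, of 0]
      have "((\<lambda>g. k (c * g)) has_integral integral {0..c * R} k / c) {0..R}"
        using c by (simp add: interval_cbox[symmetric] field_simps)
      from has_integral_mult_right[OF this, of c]
      have "((\<lambda>g. c * k (c * g)) has_integral integral {0..c * R} k) {0..R}" using c by simp
      then have "(h has_integral integral {0..c * R} k) {0..R}"
        by (subst has_integral_cong[OF h_k]) auto
      then show ?thesis by (rule integral_unique)
    qed
    have "filterlim (\<lambda>R. c * R) at_top at_top" using c by real_asymp
    from filterlim_compose[OF Ai_gen_symm_ray_tendsto[OF n y(1)] this]
    have "((\<lambda>R. integral {0..c * R} k) \<longlongrightarrow>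
        pi * y / 2 * (Ai_gen (real n) y + Ai_gen (real n) (- y))) at_top"
      by (simp add: k_def \<theta>_def)
    \<comment> \<open>The same truncated integrals, read as integrals of \<open>h\<close> up to
      \<open>R\<close>, converge to the Lebesgue integral because \<open>h\<close> is integrable;
      uniqueness of limits then equates the two values.\<close>
    moreover have "((\<lambda>R. integral {0..c * R} k) \<longlongrightarrow> (\<integral>g. h g \<partial>lborel)) at_top"
    proof (rule Lim_transform_eventually)
      show "((\<lambda>R. \<integral>g. indicator {..R} g *\<^sub>R h g \<partial>lborel) \<longlongrightarrow> (\<integral>g. h g \<partial>lborel)) at_top"
        using int by (intro tendsto_integral_at_top) auto
      show "\<forall>\<^sub>F R in at_top. (\<integral>g. indicator {..R} g *\<^sub>R h g \<partial>lborel) = integral {0..c * R} k"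
        using eventually_ge_at_top[of 0]
      proof eventually_elim
        case (elim R)
        have "set_integrable lborel {0..R} h"
          unfolding set_integrable_def by (intro integrable_mult_indicator int) auto
        from set_borel_integral_eq_integral(2)[OF this]
        have "(\<integral>g. indicator {0..R} g *\<^sub>R h g \<partial>lborel) = integral {0..R} h"
          by (simp add: set_lebesgue_integral_def)
        \<comment> \<open>The density vanishes on the negative axis, so truncating from above alone
          suffices.\<close>
        moreover have "(\<lambda>g. indicator {..R} g *\<^sub>R h g) = (\<lambda>g. indicator {0..R} g *\<^sub>R h g)"
          by (auto simp: fun_eq_iff h_def weibull_density_def split: split_indicator)
        ultimately show ?case using scale[OF elim] by simp
      qed
    qed
    ultimately have 1: "pi * y / 2 * (Ai_gen (real n) y + Ai_gen (real n) (- y)) = (\<integral>g. h g \<partial>lborel)"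
      by (intro tendsto_unique[OF trivial_limit_at_top_linorder])
    have 2: "(\<integral>g. h g \<partial>lborel) = (\<integral>\<omega>. f (G \<omega>) \<partial>M)"
      unfolding h_def by (rule distributed_integral[OF G f_meas weibull_density_nonneg[OF t]])
    have 3: "u_even n x t = 1 / (2 * c) * (Ai_gen (real n) y + Ai_gen (real n) (- y))"
      by (simp add: u_even_def c_def y_def)
    \<comment> \<open>With y = x / c the factor pi y / 2 divided by pi x is 1 / (2 c), the prefactor
      of \<open>u_even\<close>.\<close>
    show ?thesis unfolding 3 2[symmetric] 1[symmetric] y_def using c x by simp
  qed
  ultimately show ?thesis by (simp add: f_def \<theta>_def)
qed

end
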